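(* Let $G$ be a $d$-regular digraph with a walk cover $W$, and for each $k$ let $w_k(G)$ be the number of walks of length $k$ in $W$. Consider the associated walk cover of the directed line graph $L(G)$: for every ordered pair of vertices $e=(u,v)$, $f=(w,x)$ of $L(G)$, it contains the walk $e\,P\,f$, where $P$ is the walk in $W$ from $v$ to $w$. Let $w_{k}(L)$ be the number of walks of length $k$ in this associated walk cover. Then $w_{k+1}(L)=d^2\,w_k(G)$ for every $k$.
   Context: A digraph (multiple edges allowed) is $d$-regular if every vertex has in-degree and out-degree $d$. Walks may repeat vertices and edges; the length of a walk is its number of edges (a single vertex is a walk of length $0$). A walk cover of $G$ is a set $W$ of walks such that for every ordered pair of vertices $(u,v)$, where $u=v$ is allowed, $W$ contains exactly one walk from $u$ to $v$. The directed line graph $L(G)$ of $G=(V,E)$ has vertex set $E$ and a directed edge from $(u,v)$ to $(v,w)$ for every pair of edges $(u,v),(v,w)\in E$. If $P$ traverses the edges $p_1,\dots,p_k$ of $G$ in order, then $e\,P\,f$ denotes the walk in $L(G)$ visiting the vertices $e,p_1,\dots,p_k,f$ in order, which has length $k+1$. *)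

theory Defs
  imports "Graph_Theory.Digraph" "Graph_Theory.Arc_Walk"
begin

definition regular_digraph :: "('a, 'b) pre_digraph \<Rightarrow> nat \<Rightarrow> bool" where
  "regular_digraph G d \<longleftrightarrow>
     fin_digraph G \<and> (\<forall>v\<in>verts G. in_degree G v = d \<and> out_degree G v = d)"

text \<open>
  A walk is a triple of its first vertex, its list of arcs and its last vertex.
  The end points are recorded because an empty list of arcs does not determine them.
\<close>

type_synonym ('a, 'b) walk = "'a \<times> 'b list \<times> 'a"

definition walk_cover :: "('a, 'b) pre_digraph \<Rightarrow> ('a, 'b) walk set \<Rightarrow> bool" where
  "walk_cover G W \<longleftrightarrow>
     (\<forall>(u, p, v)\<in>W. pre_digraph.awalk G u p v) \<and>
     (\<forall>u\<in>verts G. \<forall>v\<in>verts G. \<exists>!p. (u, p, v) \<in> W)"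

definition num_walks :: "('a, 'b) walk set \<Rightarrow> nat \<Rightarrow> nat" where
  "num_walks W k = card {(u, p, v). (u, p, v) \<in> W \<and> length p = k}"

text \<open>
  Parallel arcs of the given digraph are distinct vertices of its line graph, so an arc of the
  line graph is determined by its end points and is represented by that pair.
\<close>

definition line_digraph :: "('a, 'b) pre_digraph \<Rightarrow> ('b, 'b \<times> 'b) pre_digraph" where
  "line_digraph G =
     \<lparr>verts = arcs G,
      arcs = {(e, f). e \<in> arcs G \<and> f \<in> arcs G \<and> head G e = tail G f},
      tail = fst, head = snd\<rparr>"

text \<open>
  The walk that visits \<open>e\<close>, the elements of \<open>p\<close> and \<open>f\<close> in this order; its arcs are the pairs
  of consecutive members of the list \<open>e # p @ [f]\<close>.
\<close>

definition line_walk :: "'b \<Rightarrow> 'b list \<Rightarrow> 'b \<Rightarrow> ('b, 'b \<times> 'b) walk" where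
  "line_walk e p f = (e, zip (e # p) (p @ [f]), f)"

definition line_cover ::
  "('a, 'b) pre_digraph \<Rightarrow> ('a, 'b) walk set \<Rightarrow> ('b, 'b \<times> 'b) walk set" where
  "line_cover G W =
     {line_walk e p f | e p f. e \<in> arcs G \<and> f \<in> arcs G \<and> (head G e, p, tail G f) \<in> W}"

lemma fin_digraph_line_digraph:
  assumes "fin_digraph G"
  shows "fin_digraph (line_digraph G)"
proof -
  interpret fin_digraph G by fact
  have "{(e, f). e \<in> arcs G \<and> f \<in> arcs G \<and> head G e = tail G f} \<subseteq> arcs G \<times> arcs G"
    by auto
  then have "finite {(e, f). e \<in> arcs G \<and> f \<in> arcs G \<and> head G e = tail G f}"
    by (rule finite_subset) simp
  then show ?thesis
    by unfold_locales (auto simp: line_digraph_def)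
qed

lemma awalk_line_walk:
  assumes "wf_digraph G" "e \<in> arcs G" "f \<in> arcs G"
    and "pre_digraph.awalk G (head G e) p (tail G f)"
  shows "pre_digraph.awalk (line_digraph G) e (zip (e # p) (p @ [f])) f"
proof -
  interpret wf_digraph G by fact
  show ?thesis using assms(2,4)
  proof (induction p arbitrary: e)
    case Nil
    then show ?case using assms(3)
      by (auto simp: pre_digraph.awalk_def pre_digraph.cas.simps line_digraph_def)
  next
    case (Cons a p)
    then have "a \<in> arcs G" "head G e = tail G a" "awalk (head G a) p (tail G f)"
      by (auto simp: awalk_Cons_iff)
    with Cons.IH[of a] Cons.prems(1) show ?case
      by (auto simp: pre_digraph.awalk_def pre_digraph.cas.simps line_digraph_def)
  qed
qed

lemma walk_cover_line_cover:
  assumes "wf_digraph G" "walk_cover G W"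
  shows "walk_cover (line_digraph G) (line_cover G W)"
proof -
  interpret wf_digraph G by fact
  have "\<exists>!q. (e, q, f) \<in> line_cover G W" if "e \<in> arcs G" "f \<in> arcs G" for e f
  proof -
    have "\<exists>!p. (head G e, p, tail G f) \<in> W"
      using assms(2) that by (auto simp: walk_cover_def)
    then obtain p where p: "(head G e, p, tail G f) \<in> W"
        "\<And>p'. (head G e, p', tail G f) \<in> W \<Longrightarrow> p' = p"
      by blast
    show ?thesis
    proof (rule ex1I[of _ "zip (e # p) (p @ [f])"])
      show "(e, zip (e # p) (p @ [f]), f) \<in> line_cover G W"
        using p(1) that by (auto simp: line_cover_def line_walk_def)
    next
      fix q assume "(e, q, f) \<in> line_cover G W"
      then obtain p' where "(head G e, p', tail G f) \<in> W" "q = zip (e # p') (p' @ [f])"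
        unfolding line_cover_def line_walk_def by blast
      then show "q = zip (e # p) (p @ [f])" using p(2) by blast
    qed
  qed
  moreover have "pre_digraph.awalk (line_digraph G) e q f" if "(e, q, f) \<in> line_cover G W" for e q f
    using that assms awalk_line_walk[OF assms(1)]
    unfolding line_cover_def line_walk_def walk_cover_def by blast
  ultimately show ?thesis
    by (auto simp: walk_cover_def line_digraph_def)
qed

end

theory Submission
  imports Defs
begin

text \<open>
  A walk of \<open>W\<close> from \<open>u\<close> to \<open>v\<close> extends to a walk of the line graph by choosing an arc into \<open>u\<close>
  and an arc out of \<open>v\<close>, which leaves \<open>d * d\<close> choices, and the extended walk determines both the
  original walk and the two arcs.
\<close>

text \<open>The triple records \<open>e\<close>, and the second components of its arc pairs spell
  \<open>p @ [f]\<close>, from which both \<open>p\<close> and \<open>f\<close> can be read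
  off.\<close>

lemma line_walk_eq_iff:
  "line_walk e p f = line_walk e' p' f' \<longleftrightarrow> e = e' \<and> p = p' \<and> f = f'"
proof
  assume "line_walk e p f = line_walk e' p' f'"
  then have eq: "e = e'" "zip (e # p) (p @ [f]) = zip (e' # p') (p' @ [f'])"
    by (auto simp: line_walk_def)
  have "map snd (zip (e # p) (p @ [f])) = map snd (zip (e' # p') (p' @ [f']))"
    by (simp only: eq(2))
  then have "p @ [f] = p' @ [f']"
    by simp
  with eq(1) show "e = e' \<and> p = p' \<and> f = f'"
    by simp
qed simp

text \<open>\<open>walk_cover\<close> asserts uniqueness, and \<open>regular_digraph\<close> the
  degrees, only at vertices; this makes both applicable to the end points of members of
  \<open>W\<close>.\<close>

lemma walk_cover_verts:
  assumes "wf_digraph G" "walk_cover G W" "(u, p, v) \<in> W"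
  shows "u \<in> verts G" "v \<in> verts G"
proof -
  interpret wf_digraph G by fact
  have "awalk u p v"
    using assms by (auto simp: walk_cover_def)
  then show "u \<in> verts G" "v \<in> verts G"
    by auto
qed

text \<open>By uniqueness a member of \<open>W\<close> is determined by its pair of end points, and
  there are finitely many such pairs.\<close>

lemma finite_walk_cover:
  assumes "fin_digraph G" "walk_cover G W"
  shows "finite W"
proof -
  interpret fin_digraph G by fact
  note verts = walk_cover_verts[OF wf_digraph_axioms assms(2)]
  have "p = q" if "(u, p, v) \<in> W" "(u, q, v) \<in> W" for u p v q
    using that verts assms(2) unfolding walk_cover_def by blast
  then have "inj_on (\<lambda>(u, p, v). (u, v)) W"
    by (auto simp: inj_on_def)
  moreover have "(\<lambda>(u, p, v). (u, v)) ` W \<subseteq> verts G \<times> verts G"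
    using verts by auto
  ultimately show ?thesis
    by (rule inj_on_finite) simp
qed

theorem theorem4:
  fixes G :: "('a, 'b) pre_digraph" and d :: nat and W :: "('a, 'b) walk set"
  assumes "regular_digraph G d"
    and "walk_cover G W"
  shows "\<forall>k. num_walks (line_cover G W) (k + 1) = d\<^sup>2 * num_walks W k"
proof
  fix k
  interpret fin_digraph G
    using assms(1) by (simp add: regular_digraph_def)
  define Wk where "Wk = {(u, p, v). (u, p, v) \<in> W \<and> length p = k}"
  define X where "X = (SIGMA (u, p, v):Wk. in_arcs G u \<times> out_arcs G v)"
  define ext :: "('a, 'b) walk \<times> 'b \<times> 'b \<Rightarrow> ('b, 'b \<times> 'b) walk"
    where "ext = (\<lambda>((u, p, v), e, f). line_walk e p f)"
  have "finite W"
    using finite_walk_cover[OF fin_digraph_axioms assms(2)] .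
  then have fin: "finite Wk"
    by (rule rev_finite_subset) (auto simp: Wk_def)
  have "inj_on ext X"
    by (auto simp: inj_on_def ext_def X_def line_walk_eq_iff)
  \<comment> \<open>\<open>in_arcs G u\<close> and \<open>out_arcs G v\<close> encode
    \<open>head G e = u\<close> and \<open>tail G f = v\<close>, the condition in
    \<open>line_cover\<close>. Both zipped lists have one entry more than \<open>p\<close>, hence
    length \<open>k + 1\<close>.\<close>
  moreover have "ext ` X = {(e, q, f). (e, q, f) \<in> line_cover G W \<and> length q = k + 1}"
    by (force simp: ext_def X_def Wk_def line_cover_def line_walk_def image_iff)
  ultimately have "num_walks (line_cover G W) (k + 1) = card X"
    unfolding num_walks_def by (metis card_image)
  also have "\<dots> = (\<Sum>(u, p, v)\<in>Wk. card (in_arcs G u \<times> out_arcs G v))"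
    unfolding X_def by (subst card_SigmaI) (auto simp: fin split_def)
  \<comment> \<open>Regularity at the end points: \<open>d\<close> arcs enter \<open>u\<close> and
    \<open>d\<close> arcs leave \<open>v\<close>.\<close>
  also have "\<dots> = (\<Sum>_\<in>Wk. d * d)"
    using assms(1) walk_cover_verts[OF wf_digraph_axioms assms(2)]
    by (intro sum.cong)
       (auto simp: Wk_def card_cartesian_product regular_digraph_def in_degree_def out_degree_def)
  also have "\<dots> = d\<^sup>2 * num_walks W k"
    by (simp add: num_walks_def Wk_def power2_eq_square)
  finally show "num_walks (line_cover G W) (k + 1) = d\<^sup>2 * num_walks W k" .
qed

end
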